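(* Consider directed graphs without antiparallel edges, and let $\Psi_{\mathrm{sink}}$ be the property of containing a sink. Then $\Psi_{\mathrm{sink}}$ is nontrivial on $k$-vertex graphs for every $k\geq 2$ (i.e. some $k$-vertex directed graph without antiparallel edges has a sink and some other does not), and the following problem can be solved in linear time: given a directed graph $G$ without antiparallel edges and $k\in\mathbb{N}$, compute the number of $k$-element subsets $X\subseteq V(G)$ such that the induced subgraph $G[X]$ contains a sink.
   Context: Directed graphs are finite, without self-loops or multiple edges; "without antiparallel edges" means that for any two vertices $u,v$ at most one of the edges $(u,v)$ and $(v,u)$ is present. A sink of a directed graph $H$ is a vertex $s\in V(H)$ such that $(u,s)\in E(H)$ for all $u\in V(H)\setminus\{s\}$. *)

theory Defs
  imports "Graph_Theory.Digraph_Component" "HOL-Library.Log_Nat"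
begin

section \<open>Directed graphs without antiparallel edges, and sinks\<close>

text \<open>The locale \<open>digraph\<close> of Graph_Theory already means: finite, no loops, no multiple arcs.\<close>

definition oriented_digraph :: "('a, 'b) pre_digraph \<Rightarrow> bool" where
  "oriented_digraph G \<longleftrightarrow> digraph G \<and> (\<forall>u v. u \<rightarrow>\<^bsub>G\<^esub> v \<longrightarrow> \<not> v \<rightarrow>\<^bsub>G\<^esub> u)"

definition is_sink :: "('a, 'b) pre_digraph \<Rightarrow> 'a \<Rightarrow> bool" where
  "is_sink H s \<longleftrightarrow> s \<in> verts H \<and> (\<forall>u \<in> verts H - {s}. u \<rightarrow>\<^bsub>H\<^esub> s)"

definition has_sink :: "('a, 'b) pre_digraph \<Rightarrow> bool" where
  "has_sink H \<longleftrightarrow> (\<exists>s. is_sink H s)"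

definition num_ind_sub ::
    "(('a, 'b) pre_digraph \<Rightarrow> bool) \<Rightarrow> ('a, 'b) pre_digraph \<Rightarrow> nat \<Rightarrow> nat" where
  "num_ind_sub \<Psi> G k = card {X. X \<subseteq> verts G \<and> card X = k \<and> \<Psi> (G \<restriction> X)}"


section \<open>Random access machine with unit-cost arithmetic\<close>

text \<open>
  A machine has directly addressed registers, of which a program can mention only finitely many,
  and a separate memory that is accessed only through an address held in a register.
  Both hold natural numbers; each instruction takes one time step.
\<close>

datatype instr =
    SETC nat nat        \<comment> \<open>\<open>R\<^sub>i := c\<close>\<close>
  | MOVE nat nat        \<comment> \<open>\<open>R\<^sub>i := R\<^sub>j\<close>\<close>
  | LOAD nat nat        \<comment> \<open>\<open>R\<^sub>i := M[R\<^sub>j]\<close>\<close>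
  | STORE nat nat       \<comment> \<open>\<open>M[R\<^sub>i] := R\<^sub>j\<close>\<close>
  | ADD nat nat nat     \<comment> \<open>\<open>R\<^sub>i := R\<^sub>j + R\<^sub>k\<close>\<close>
  | SUB nat nat nat     \<comment> \<open>truncated at 0\<close>
  | MUL nat nat nat
  | DIV nat nat nat     \<comment> \<open>rounded down; division by 0 gives 0\<close>
  | JMP nat
  | JMPZ nat nat        \<comment> \<open>jump to the second argument if the register is 0\<close>

record ram_state =
  pc :: nat
  reg :: "nat \<Rightarrow> nat"
  mem :: "nat \<Rightarrow> nat"

definition set_reg :: "ram_state \<Rightarrow> nat \<Rightarrow> nat \<Rightarrow> ram_state" where
  "set_reg s i x = s\<lparr>pc := Suc (pc s), reg := (reg s)(i := x)\<rparr>"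

fun exec :: "instr \<Rightarrow> ram_state \<Rightarrow> ram_state" where
  "exec (SETC i c) s = set_reg s i c"
| "exec (MOVE i j) s = set_reg s i (reg s j)"
| "exec (LOAD i j) s = set_reg s i (mem s (reg s j))"
| "exec (STORE i j) s = s\<lparr>pc := Suc (pc s), mem := (mem s)(reg s i := reg s j)\<rparr>"
| "exec (ADD i j k) s = set_reg s i (reg s j + reg s k)"
| "exec (SUB i j k) s = set_reg s i (reg s j - reg s k)"
| "exec (MUL i j k) s = set_reg s i (reg s j * reg s k)"
| "exec (DIV i j k) s = set_reg s i (reg s j div reg s k)"
| "exec (JMP l) s = s\<lparr>pc := l\<rparr>"
| "exec (JMPZ i l) s = s\<lparr>pc := (if reg s i = 0 then l else Suc (pc s))\<rparr>"

text \<open>The machine halts when the program counter leaves the program.\<close>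

definition halted :: "instr list \<Rightarrow> ram_state \<Rightarrow> bool" where
  "halted P s \<longleftrightarrow> pc s \<ge> length P"

definition step :: "instr list \<Rightarrow> ram_state \<Rightarrow> ram_state" where
  "step P s = (if halted P s then s else exec (P ! pc s) s)"

definition init_state :: "nat list \<Rightarrow> ram_state" where
  "init_state xs =
     \<lparr>pc = 0,
      reg = (\<lambda>i. if i = 0 then length xs else 0),
      mem = (\<lambda>i. if i < length xs then xs ! i else 0)\<rparr>"

definition run :: "instr list \<Rightarrow> nat list \<Rightarrow> nat \<Rightarrow> ram_state" where
  "run P xs t = (step P ^^ t) (init_state xs)"

text \<open>Bit length of an input; \<open>floorlog 2 x\<close> is the number of binary digits of \<open>x\<close>.\<close>

definition input_bits :: "nat list \<Rightarrow> nat" where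
  "input_bits xs = (\<Sum>x\<leftarrow>xs. Suc (floorlog 2 x))"

text \<open>
  A problem relates inputs to correct answers; lists related to no answer are not inputs.
  Time is linear in the number of input words. With unit-cost multiplication on unbounded numbers
  a machine would be unreasonably powerful (repeated squaring), so every number that occurs in
  the computation must have bit length linear in the bit length of the input.
\<close>

definition linear_time_solvable :: "(nat list \<Rightarrow> nat \<Rightarrow> bool) \<Rightarrow> bool" where
  "linear_time_solvable Q \<longleftrightarrow>
     (\<exists>P c. \<forall>xs y. Q xs y \<longrightarrow>
        (\<exists>t \<le> c * Suc (length xs).
           halted P (run P xs t) \<and> reg (run P xs t) 0 = y \<and>
           (\<forall>t' \<le> t. \<forall>i.
              reg (run P xs t') i < 2 ^ (c * Suc (input_bits xs)) \<and>
              mem (run P xs t') i < 2 ^ (c * Suc (input_bits xs)))))"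


section \<open>Graphs as inputs\<close>

text \<open>
  The input \<open>(G, k)\<close> is given by adjacency lists: the vertices are numbered \<open>0, \<dots>, n - 1\<close> in an
  arbitrary way, and the words are \<open>k\<close>, \<open>n\<close>, and then for each vertex its number of out-neighbours
  followed by these out-neighbours in arbitrary order. So the input has
  \<open>n + m + 2\<close> words, where \<open>m\<close> is the number of arcs.
\<close>

definition encodes :: "nat list \<Rightarrow> ('a, 'b) pre_digraph \<Rightarrow> nat \<Rightarrow> bool" where
  "encodes xs G k \<longleftrightarrow>
     (\<exists>n f adj. bij_betw f {..<n} (verts G) \<and>
        (\<forall>i<n. distinct (adj i) \<and> set (adj i) = {j. j < n \<and> f i \<rightarrow>\<^bsub>G\<^esub> f j}) \<and>
        xs = k # n # concat (map (\<lambda>i. length (adj i) # adj i) [0..<n]))"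

text \<open>Natural numbers as vertices suffice: every finite digraph has an isomorphic copy on them.\<close>

definition count_sink_problem :: "nat list \<Rightarrow> nat \<Rightarrow> bool" where
  "count_sink_problem xs y \<longleftrightarrow>
     (\<exists>(G :: (nat, nat \<times> nat) pre_digraph) k.
        oriented_digraph G \<and> encodes xs G k \<and> y = num_ind_sub has_sink G k)"

end

(* A set has at most one sink because two sinks would be joined by antiparallel arcs. Hence, with
   r = k - 1, the number of k-sets with a sink is the sum over all vertices v of the binomial
   coefficients (indeg v choose r). A single pass over the adjacency lists computes it: each vertex w
   stores its current in-degree d and (d choose r), and an arc into w replaces the latter by
   (d choose r) * (d + 1) div (d + 1 - r), the increment being added to the total. *)
theory Submission
  imports Defs
begin

section \<open>Counting sets that induce a sink\<close>

lemma dominates_induce_subgraph_iff: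
  "u \<rightarrow>\<^bsub>G \<restriction> X\<^esub> v \<longleftrightarrow> u \<rightarrow>\<^bsub>G\<^esub> v \<and> u \<in> X \<and> v \<in> X"
  by (auto simp: arcs_ends_def arc_to_ends_def)

lemma has_sink_induce_subgraph_iff:
  "has_sink (G \<restriction> X) \<longleftrightarrow> (\<exists>s\<in>X. \<forall>u\<in>X - {s}. u \<rightarrow>\<^bsub>G\<^esub> s)"
  unfolding has_sink_def is_sink_def by (auto simp: dominates_induce_subgraph_iff)

lemma oriented_digraph_dominatesD:
  assumes "oriented_digraph G" "u \<rightarrow>\<^bsub>G\<^esub> v"
  shows "u \<in> verts G" "v \<in> verts G" "\<not> v \<rightarrow>\<^bsub>G\<^esub> u"
proof -
  interpret digraph G using assms by (simp add: oriented_digraph_def)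
  show "u \<in> verts G" "v \<in> verts G" using assms(2) by (auto dest: adj_in_verts)
  show "\<not> v \<rightarrow>\<^bsub>G\<^esub> u" using assms by (auto simp: oriented_digraph_def)
qed

lemma finite_verts_oriented_digraph: "oriented_digraph G \<Longrightarrow> finite (verts G)"
  by (auto simp: oriented_digraph_def digraph_def fin_digraph_def fin_digraph_axioms_def)

text \<open>The empty set has no sink. Finiteness matters because \<open>card\<close> is also 0 on
  infinite sets.\<close>

lemma num_ind_sub_has_sink_0: "num_ind_sub has_sink G 0 = 0" if "finite (verts G)"
proof -
  have "{X. X \<subseteq> verts G \<and> card X = 0 \<and> has_sink (G \<restriction> X)} = {}"
    using that by (auto simp: has_sink_induce_subgraph_iff card_eq_0_iff dest: finite_subset)
  then show ?thesis unfolding num_ind_sub_def by (simp only: card.empty)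
qed

text \<open>A set inducing a sink splits uniquely into
  its sink and a set of in-neighbours.\<close>

lemma num_ind_sub_has_sink_Suc:
  assumes G: "oriented_digraph G"
  shows "num_ind_sub has_sink G (Suc r) = (\<Sum>v\<in>verts G. card {u. u \<rightarrow>\<^bsub>G\<^esub> v} choose r)"
proof -
  define N where "N v = {u. u \<rightarrow>\<^bsub>G\<^esub> v}" for v
  \<comment> \<open>\<open>S v\<close> is the family of \<open>Suc r\<close>-sets in which
    \<open>v\<close> is a sink, as \<open>mem_S\<close> shows below.\<close>
  define S where "S v = insert v ` {Y. Y \<subseteq> N v \<and> card Y = r}" for v
  note fin = finite_verts_oriented_digraph[OF G]
  have finN: "finite (N v)" for v
    by (rule finite_subset[OF _ fin]) (auto simp: N_def dest: oriented_digraph_dominatesD[OF G])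
  have self: "v \<notin> N v" for v
    using oriented_digraph_dominatesD(3)[OF G] by (auto simp: N_def)
  have finS: "finite (S v)" for v
    using finN by (auto simp: S_def)
  have cardS: "card (S v) = card (N v) choose r" for v
  proof -
    have "inj_on (insert v) {Y. Y \<subseteq> N v \<and> card Y = r}"
      using self[of v] by (intro inj_onI) (metis (lifting) insert_ident mem_Collect_eq subsetD)
    then show ?thesis by (simp add: S_def card_image n_subsets finN)
  qed
  have mem_S: "X \<in> S v \<longleftrightarrow> v \<in> X \<and> X - {v} \<subseteq> N v \<and> card X = Suc r" for X v
  proof
    assume "X \<in> S v"
    then obtain Y where Y: "X = insert v Y" "Y \<subseteq> N v" "card Y = r" by (auto simp: S_def)
    then have "v \<notin> Y" "finite Y" using self[of v] finN[of v] by (auto dest: finite_subset)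
    then show "v \<in> X \<and> X - {v} \<subseteq> N v \<and> card X = Suc r" using Y by auto
  next
    assume "v \<in> X \<and> X - {v} \<subseteq> N v \<and> card X = Suc r"
    then show "X \<in> S v"
      unfolding S_def by (intro image_eqI[of _ _ "X - {v}"]) (auto simp: insert_absorb)
  qed
  have disj: "S v \<inter> S w = {}" if "v \<noteq> w" for v w
  proof -
    have False if "X \<in> S v" "X \<in> S w" for X
    proof -
      have "w \<in> N v" "v \<in> N w" using that \<open>v \<noteq> w\<close> unfolding mem_S by auto
      then show False using oriented_digraph_dominatesD(3)[OF G] by (auto simp: N_def)
    qed
    then show ?thesis by auto
  qed
  have "{X. X \<subseteq> verts G \<and> card X = Suc r \<and> has_sink (G \<restriction> X)} = (\<Union>v\<in>verts G. S v)"
    (is "?A = ?B")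
  proof
    show "?A \<subseteq> ?B"
      unfolding has_sink_induce_subgraph_iff by (fastforce simp: mem_S N_def)
    show "?B \<subseteq> ?A"
    proof
      fix X assume "X \<in> ?B"
      then obtain v where v: "v \<in> verts G" "v \<in> X" "X - {v} \<subseteq> N v" "card X = Suc r"
        by (auto simp: mem_S)
      then have "X \<subseteq> verts G" using oriented_digraph_dominatesD(1)[OF G] by (auto simp: N_def)
      then show "X \<in> ?A" using v by (auto simp: has_sink_induce_subgraph_iff N_def)
    qed
  qed
  then have "num_ind_sub has_sink G (Suc r) = card (\<Union>v\<in>verts G. S v)"
    by (simp add: num_ind_sub_def)
  also have "\<dots> = (\<Sum>v\<in>verts G. card (S v))"
    using fin finS disj by (intro card_UN_disjoint) auto
  finally show ?thesis by (simp add: cardS N_def)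
qed


section \<open>Decoding adjacency lists\<close>

text \<open>The counter is the number of targets left in the current list; at 0 the next word is an
  out-degree and reloads it. This mirrors register 5 of the program.\<close>

fun arc_targets :: "nat \<Rightarrow> nat list \<Rightarrow> nat list" where
  "arc_targets c [] = []"
| "arc_targets 0 (w # ws) = arc_targets w ws"
| "arc_targets (Suc c) (w # ws) = w # arc_targets c ws"

lemma arc_targets_append: "arc_targets (length a) (a @ ws) = a @ arc_targets 0 ws"
  by (induction a) auto

lemma arc_targets_concat:
  "arc_targets 0 (concat (map (\<lambda>i. length (adj i) # adj i) is)) = concat (map adj is)"
  by (induction "is") (auto simp: arc_targets_append)

lemma count_list_distinct: "distinct xs \<Longrightarrow> count_list xs x = (if x \<in> set xs then 1 else 0)"
  by (induction xs) auto

lemma count_list_concat_map: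
  assumes "distinct is" "\<And>i. i \<in> set is \<Longrightarrow> distinct (adj i)"
  shows "count_list (concat (map adj is)) j = card {i \<in> set is. j \<in> set (adj i)}"
  using assms
proof (induction "is")
  case (Cons a xs)
  have "{i \<in> set (a # xs). j \<in> set (adj i)} =
      (if j \<in> set (adj a) then insert a {i \<in> set xs. j \<in> set (adj i)}
       else {i \<in> set xs. j \<in> set (adj i)})"
    by auto
  moreover have "count_list (adj a) j = (if j \<in> set (adj a) then 1 else 0)"
    using Cons.prems by (simp add: count_list_distinct)
  ultimately show ?case
    using Cons by (auto simp: count_list_append)
qed simp

section \<open>Binomial coefficients updated arc by arc\<close>

text \<open>The convention for \<open>r = 0\<close> makes the value at 0 vanish for all \<open>r\<close>, as the memory does initially.\<close>

definition pos_choose :: "nat \<Rightarrow> nat \<Rightarrow> nat" where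
  "pos_choose r d = (if r = 0 then 0 else d choose r)"

lemma pos_choose_0[simp]: "pos_choose r 0 = 0"
  by (auto simp: pos_choose_def)

text \<open>Ensures that the truncated subtraction in the increment of the total is exact.\<close>

lemma pos_choose_mono: "pos_choose r d \<le> pos_choose r (Suc d)"
  by (cases r) (auto simp: pos_choose_def)

lemma pos_choose_le: "pos_choose r d \<le> 2 ^ d"
  by (simp add: pos_choose_def binomial_le_pow2)

text \<open>The second summand is 1 if \<open>r = Suc d\<close> and 0 otherwise; division by 0 gives 0
  in the first one if \<open>Suc d \<le> r\<close>.\<close>

lemma pos_choose_Suc:
  "pos_choose r (Suc d) =
     pos_choose r d * Suc d div (Suc d - r) + Suc 0 div Suc (r - Suc d + (Suc d - r))"
proof (cases r)
  case 0
  then show ?thesis by (simp add: pos_choose_def)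
next
  case (Suc q)
  consider "Suc d < r" | "Suc d = r" | "r < Suc d" by linarith
  then show ?thesis
  proof cases
    case 3
    \<comment> \<open>The absorption identity shows that the division is exact.\<close>
    then have "(Suc d choose r) * (Suc d - r) = (d choose r) * Suc d"
      by (metis binomial_absorb_comp mult.commute diff_Suc_1)
    then have "(d choose r) * Suc d div (Suc d - r) = Suc d choose r"
      using 3 by (metis nonzero_mult_div_cancel_right zero_less_diff less_numeral_extra(3))
    then show ?thesis using 3 Suc by (simp add: pos_choose_def)
  qed (use Suc in \<open>auto simp: pos_choose_def\<close>)
qed

text \<open>For the list of all arc targets, multiplicities are in-degrees. Vertices of in-degree 0
  may be left out since \<open>pos_choose r 0 = 0\<close>.\<close>

definition choose_sum :: "nat \<Rightarrow> nat list \<Rightarrow> nat" where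
  "choose_sum r ws = (\<Sum>v\<in>set ws. pos_choose r (count_list ws v))"

lemma choose_sum_superset:
  assumes "finite A" "set ws \<subseteq> A"
  shows "choose_sum r ws = (\<Sum>v\<in>A. pos_choose r (count_list ws v))"
  unfolding choose_sum_def using assms
  by (intro sum.mono_neutral_left) (auto simp: count_list_0_iff)

lemma choose_sum_snoc:
  "choose_sum r (ws @ [w]) =
     choose_sum r ws + (pos_choose r (Suc (count_list ws w)) - pos_choose r (count_list ws w))"
proof -
  let ?A = "insert w (set ws)"
  have "choose_sum r (ws @ [w]) = (\<Sum>v\<in>?A. pos_choose r (count_list (ws @ [w]) v))"
    by (rule choose_sum_superset) auto
  moreover have "choose_sum r ws = (\<Sum>v\<in>?A. pos_choose r (count_list ws v))"
    by (rule choose_sum_superset) auto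
  ultimately show ?thesis
    using pos_choose_mono[of r "count_list ws w"]
    by (simp add: sum.remove[where A = ?A and x = w])
qed

text \<open>There are at most \<open>L\<close> distinct entries, each occurring at most
  \<open>L\<close> times. This bounds the total held by the machine.\<close>

lemma choose_sum_le:
  assumes "length ws \<le> L"
  shows "choose_sum r ws \<le> L * 2 ^ L"
proof -
  have "choose_sum r ws \<le> card (set ws) * 2 ^ L"
    unfolding choose_sum_def
  proof (rule order.trans[OF sum_bounded_above])
    fix v
    have "pos_choose r (count_list ws v) \<le> 2 ^ count_list ws v" by (rule pos_choose_le)
    also have "\<dots> \<le> 2 ^ L"
      using count_le_length[of ws v] assms by (intro power_increasing) auto
    finally show "pos_choose r (count_list ws v) \<le> 2 ^ L" .
  qed simp
  also have "\<dots> \<le> L * 2 ^ L"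
    using card_length[of ws] assms by (intro mult_right_mono) auto
  finally show ?thesis .
qed

text \<open>The index \<open>j\<close> occurs exactly once in the list of each in-neighbour, and
  \<open>f\<close> carries indices bijectively to vertices.\<close>

lemma encodes_count_list:
  assumes G: "oriented_digraph G" and f: "bij_betw f {..<n} (verts G)"
    and adj: "\<forall>i<n. distinct (adj i) \<and> set (adj i) = {j. j < n \<and> f i \<rightarrow>\<^bsub>G\<^esub> f j}"
    and "j < n"
  shows "count_list (concat (map adj [0..<n])) j = card {u. u \<rightarrow>\<^bsub>G\<^esub> f j}"
proof -
  have "count_list (concat (map adj [0..<n])) j = card {i \<in> set [0..<n]. j \<in> set (adj i)}"
    using adj by (intro count_list_concat_map) auto
  also have "\<dots> = card (f ` {i \<in> set [0..<n]. j \<in> set (adj i)})"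
    by (rule card_image[symmetric], rule inj_on_subset[OF bij_betw_imp_inj_on[OF f]]) auto
  also have "f ` {i \<in> set [0..<n]. j \<in> set (adj i)} = {u. u \<rightarrow>\<^bsub>G\<^esub> f j}" (is "?A = ?B")
  proof
    show "?A \<subseteq> ?B" using adj by auto
    show "?B \<subseteq> ?A"
    proof
      fix u assume "u \<in> ?B"
      then have "u \<in> f ` {..<n}"
        using f oriented_digraph_dominatesD(1)[OF G] by (auto simp: bij_betw_def)
      then show "u \<in> ?A" using \<open>u \<in> ?B\<close> adj \<open>j < n\<close> by auto
    qed
  qed
  finally show ?thesis .
qed

lemma encodes_num_ind_sub_has_sink:
  assumes G: "oriented_digraph G" and enc: "encodes xs G k"
  obtains n ws where "xs = k # n # ws" "n \<le> length ws"
    "num_ind_sub has_sink G k = (if k = 1 then n else 0) + choose_sum (k - 1) (arc_targets 0 ws)"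
proof -
  from enc obtain n f adj where f: "bij_betw f {..<n} (verts G)"
    and adj: "\<forall>i<n. distinct (adj i) \<and> set (adj i) = {j. j < n \<and> f i \<rightarrow>\<^bsub>G\<^esub> f j}"
    and xs: "xs = k # n # concat (map (\<lambda>i. length (adj i) # adj i) [0..<n])"
    unfolding encodes_def by blast
  let ?ws = "concat (map (\<lambda>i. length (adj i) # adj i) [0..<n])"
  have len: "n \<le> length ?ws" by (induction n) auto
  have card: "card (verts G) = n" using bij_betw_same_card[OF f] by simp
  have "num_ind_sub has_sink G k = (if k = 1 then n else 0) + choose_sum (k - 1) (concat (map adj [0..<n]))"
  proof (cases k)
    \<comment> \<open>Here \<open>k - 1\<close> truncates to 0, where \<open>pos_choose\<close>
      vanishes, in agreement with the count 0.\<close>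
    case 0
    then show ?thesis
      using num_ind_sub_has_sink_0[OF finite_verts_oriented_digraph[OF G]]
      by (simp add: choose_sum_def pos_choose_def)
  next
    case (Suc r)
    have "choose_sum r (concat (map adj [0..<n])) =
        (\<Sum>j<n. pos_choose r (count_list (concat (map adj [0..<n])) j))"
      using adj by (intro choose_sum_superset) auto
    also have "\<dots> = (\<Sum>j<n. pos_choose r (card {u. u \<rightarrow>\<^bsub>G\<^esub> f j}))"
      by (intro sum.cong) (auto simp: encodes_count_list[OF G f adj])
    also have "\<dots> = (\<Sum>v\<in>verts G. pos_choose r (card {u. u \<rightarrow>\<^bsub>G\<^esub> v}))"
      by (rule sum.reindex_bij_betw[OF f])
    finally show ?thesis
      using Suc num_ind_sub_has_sink_Suc[OF G, of r] card
      by (auto simp: pos_choose_def)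
  qed
  then show thesis using that[of n ?ws] xs len by (simp add: arc_targets_concat)
qed


section \<open>Bounded runs of the machine\<close>

definition below :: "nat \<Rightarrow> (nat \<Rightarrow> nat) \<Rightarrow> bool" where
  "below N f \<longleftrightarrow> (\<forall>i. f i < N)"

lemma below_upd[simp]: "below N f \<Longrightarrow> x < N \<Longrightarrow> below N (f(i := x))"
  by (simp add: below_def)

text \<open>Peeling off the first step lets the simplifier run the program symbolically, with the
  size bounds left as side conditions.\<close>

primrec reaches ::
    "instr list \<Rightarrow> nat \<Rightarrow> nat \<Rightarrow> ram_state \<Rightarrow> (ram_state \<Rightarrow> bool) \<Rightarrow> bool" where
  "reaches P N 0 s Q \<longleftrightarrow> below N (reg s) \<and> below N (mem s) \<and> Q s"
| "reaches P N (Suc t) s Q \<longleftrightarrow> below N (reg s) \<and> below N (mem s) \<and> reaches P N t (step P s) Q"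

lemma reaches_numeral_record:
  "reaches P N (numeral t) \<lparr>pc = i, reg = R, mem = M\<rparr> Q \<longleftrightarrow>
     below N R \<and> below N M \<and> reaches P N (pred_numeral t)
       (if length P \<le> i then \<lparr>pc = i, reg = R, mem = M\<rparr>
        else exec (P ! i) \<lparr>pc = i, reg = R, mem = M\<rparr>) Q"
  by (simp add: numeral_eq_Suc step_def halted_def)

lemma reaches_Suc_0_record:
  "reaches P N (Suc 0) \<lparr>pc = i, reg = R, mem = M\<rparr> Q \<longleftrightarrow>
     below N R \<and> below N M \<and> reaches P N 0
       (if length P \<le> i then \<lparr>pc = i, reg = R, mem = M\<rparr>
        else exec (P ! i) \<lparr>pc = i, reg = R, mem = M\<rparr>) Q"
  by (simp add: step_def halted_def)

text \<open>Sequential composition. The bounds on \<open>s'\<close> are handed over because the next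
  segment starts from them.\<close>

lemma reaches_trans:
  assumes "reaches P N t s Q"
    and "\<And>s'. Q s' \<Longrightarrow> below N (reg s') \<Longrightarrow> below N (mem s') \<Longrightarrow> \<exists>t'\<le>T. reaches P N t' s' Q'"
  shows "\<exists>t'\<le>t + T. reaches P N t' s Q'"
  using assms(1)
proof (induction t arbitrary: s)
  case (Suc t)
  then obtain t' where "t' \<le> t + T" "reaches P N t' (step P s) Q'" by auto
  then show ?case using Suc.prems by (intro exI[of _ "Suc t'"]) auto
qed (use assms(2) in auto)

lemma reaches_iff:
  "reaches P N t s Q \<longleftrightarrow> Q ((step P ^^ t) s) \<and>
     (\<forall>t'\<le>t. below N (reg ((step P ^^ t') s)) \<and> below N (mem ((step P ^^ t') s)))"
proof (induction t arbitrary: s)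
  case (Suc t)
  have "(\<forall>t'\<le>Suc t. R t') \<longleftrightarrow> R 0 \<and> (\<forall>t'\<le>t. R (Suc t'))" for R :: "nat \<Rightarrow> bool"
    by (metis Suc_le_mono le0 not0_implies_Suc)
  then show ?case by (simp add: Suc.IH funpow_Suc_right del: funpow.simps) (simp add: funpow.simps conj_ac)
qed auto


section \<open>The program\<close>

text \<open>
  With \<open>L\<close> the number of input words and \<open>r = k - 1\<close>: register 0 holds the total, 2 the constant 1,
  3 the position of the next word, 4 the number \<open>r\<close>, 5 the number of targets left in the current
  adjacency list, and 9 the number \<open>L\<close>. Cells \<open>2 w + L\<close> and \<open>2 w + L + 1\<close> hold the number \<open>d\<close> of
  arcs into \<open>w\<close> seen so far and \<open>pos_choose r d\<close>.
  Since \<open>pos_choose 0\<close> vanishes, the total starts with the number of vertices if \<open>k = 1\<close>. The loop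
  begins at instruction 12; instruction 37 handles a word that is an out-degree.
\<close>

definition sink_program :: "instr list" where
  "sink_program =
    [MOVE 9 0, SETC 2 1, LOAD 4 3, LOAD 5 2,
     SUB 6 2 4, SUB 4 4 2, ADD 6 6 4, ADD 6 6 2, DIV 6 2 6, MUL 0 6 5,
     ADD 3 2 2, SETC 5 0,
     SUB 6 9 3, JMPZ 6 39, LOAD 6 3, ADD 3 3 2, JMPZ 5 37,
     SUB 5 5 2, ADD 6 6 6, ADD 6 6 9,
     LOAD 7 6, ADD 7 7 2, STORE 6 7,
     ADD 6 6 2, LOAD 8 6,
     MUL 10 8 7, SUB 11 7 4, DIV 10 10 11,
     SUB 7 4 7, ADD 7 7 11, ADD 7 7 2, DIV 7 2 7, ADD 10 10 7,
     STORE 6 10, SUB 8 10 8, ADD 0 0 8, JMP 12,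
     MOVE 5 6, JMP 12]"

section \<open>Execution of the program segments and the loop invariant\<close>

lemma length_sink_program: "length sink_program = 39"
  by (simp add: sink_program_def)

lemmas sink_program_nth = arg_cong[where f = "\<lambda>P. P ! i", OF sink_program_def] for i

lemmas exec_simps =
  reaches_numeral_record reaches_Suc_0_record length_sink_program sink_program_nth set_reg_def

text \<open>The truncated differences \<open>1 - k\<close> and \<open>k - 1\<close> add up to the
  distance of \<open>k\<close> from 1, so dividing 1 by its successor tests \<open>k = 1\<close>
  without a branch; the result is multiplied by \<open>n\<close>.\<close>

lemma sink_program_start:
  assumes "below N R" "below N M" "R 0 = L" "R 3 = 0" "M 0 = k" "M (Suc 0) = n"
    and "k + 3 < N" "n < N"
  shows "reaches sink_program N 12 \<lparr>pc = 0, reg = R, mem = M\<rparr>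
    (\<lambda>s. pc s = 12 \<and> reg s 0 = (if k = 1 then n else 0) \<and> reg s 2 = 1 \<and> reg s 3 = 2 \<and>
         reg s 4 = k - 1 \<and> reg s 5 = 0 \<and> reg s 9 = L \<and> mem s = M)"
proof -
  have "L < N" using assms(1,3) by (auto simp: below_def)
  moreover have "k < N" "k - Suc 0 < N" "Suc 0 < N" "Suc (Suc 0) < N" "0 < N" "Suc 0 - k < N"
      "Suc 0 - k + (k - Suc 0) < N" "Suc (Suc 0 - k + (k - Suc 0)) < N"
    using assms(7) by linarith+
  moreover  have "Suc 0 div Suc (Suc 0 - k + (k - Suc 0)) = (if k = Suc 0 then 1 else 0)"
    by (cases "k = Suc 0") (auto intro: div_less)
  ultimately show ?thesis
    by (simp add: exec_simps assms del: reaches.simps(2))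
qed

lemma sink_program_halt:
  assumes "below N R" "below N M" "R 3 = R 9"
  shows "reaches sink_program N 2 \<lparr>pc = 12, reg = R, mem = M\<rparr>
    (\<lambda>s. pc s = 39 \<and> reg s 0 = R 0)"
proof -
  have "0 < N" using assms by (auto simp: below_def intro: le_less_trans)
  then show ?thesis
    by (simp add: exec_simps assms del: reaches.simps(2))
qed

lemma sink_program_degree:
  assumes "below N R" "below N M" "R 2 = 1" "R 3 < R 9" "R 5 = 0"
  shows "reaches sink_program N 7 \<lparr>pc = 12, reg = R, mem = M\<rparr>
    (\<lambda>s. pc s = 12 \<and> reg s 0 = R 0 \<and> reg s 2 = 1 \<and> reg s 3 = Suc (R 3) \<and> reg s 4 = R 4 \<and>
         reg s 5 = M (R 3) \<and> reg s 9 = R 9 \<and> mem s = M)"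
proof -
  have "M (R 3) < N" "R 9 < N" using assms(1,2) by (simp_all add: below_def)
  moreover from this have "R 9 - R 3 < N" "Suc (R 3) < N" "\<not> R 9 \<le> R 3"
    using assms(4) by linarith+
  ultimately show ?thesis
    by (simp add: exec_simps assms del: reaches.simps(2))
qed

text \<open>\<open>B'\<close> is described only by the arithmetic that the machine performs;
  \<open>pos_choose_Suc\<close> identifies it when the lemma is applied.\<close>

lemma sink_program_target:
  fixes L w d :: nat
  assumes "below N R" "below N M" "R 2 = 1" "R 3 < L" "R 4 = r" "R 5 = Suc c" "R 9 = L"
    and "M (R 3) = w" "M (w + w + L) = d" "M (Suc (w + w + L)) = B"
    and B': "B * Suc d div (Suc d - r) + Suc 0 div Suc (r - Suc d + (Suc d - r)) = B'"
    and "Suc (w + w + L) < N" "B * Suc d < N" "Suc (r + Suc d) < N" "B' < N" "R 0 + (B' - B) < N"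
  shows "reaches sink_program N 25 \<lparr>pc = 12, reg = R, mem = M\<rparr>
    (\<lambda>s. pc s = 12 \<and> reg s 0 = R 0 + (B' - B) \<and> reg s 2 = 1 \<and> reg s 3 = Suc (R 3) \<and>
         reg s 4 = r \<and> reg s 5 = c \<and> reg s 9 = L \<and>
         mem s = M(w + w + L := Suc d, Suc (w + w + L) := B'))"
proof -
  have "R 5 < N" "B < N" using assms(1,2,10) unfolding below_def by blast+
  then have bounds: "L - R 3 < N" "Suc (R 3) < N" "w < N" "L < N" "\<not> L \<le> R 3" "c < N"
      "w + w < N" "w + w + L < N" "Suc d < N" "Suc d - r < N" "r - Suc d < N" "d < N" "B < N"
      "r - Suc d + (Suc d - r) < N" "Suc (r - Suc d + (Suc d - r)) < N" "B' - B < N"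
      "r < N"
    using assms(4,6,12-16) by simp_all
  \<comment> \<open>Both quotients are summands of \<open>B'\<close>, hence inherit its
    bound.\<close>
  have quot: "B * Suc d div (Suc d - r) \<le> B'"
      "Suc 0 div Suc (r - Suc d + (Suc d - r)) \<le> B'"
    unfolding B'[symmetric] by (rule le_add1 le_add2)+
  then have quot_less: "B * Suc d div (Suc d - r) < N"
      "Suc 0 div Suc (r - Suc d + (Suc d - r)) < N"
    using \<open>B' < N\<close> by (auto dest: le_less_trans)
  show ?thesis
    by (simp add: exec_simps assms(1-10) B' bounds quot_less assms(12-)
        del: reaches.simps(2) mult_Suc_right)
qed

text \<open>Induction on the unread words \<open>ws\<close>, where \<open>as\<close> lists the
  targets already processed and the memory holds their counts and coefficients. Input words and
  \<open>2 ^ L\<close> are bounded by \<open>K\<close>, so every value stays below a multiple of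
  \<open>K * K\<close>. A word costs at most 25 steps, halting 2.\<close>

lemma sink_program_loop:
  fixes K L N r :: nat and xs ws as :: "nat list"
  assumes L: "L = length xs" "L < K" "2 ^ L \<le> K" and xs: "\<forall>x\<in>set xs. x < K"
    and "r < K" "t0 \<le> K" and N: "8 * (K * K) \<le> N"
  assumes "pc s = 12" "below N (reg s)" "below N (mem s)"
    "reg s 0 = t0 + choose_sum r as" "reg s 2 = 1" "reg s 3 = p" "reg s 4 = r" "reg s 5 = c"
    "reg s 9 = L"
    and "drop p xs = ws" "length as \<le> p" "p \<le> L"
    and "\<forall>j<L. mem s j = xs ! j"
    and "\<forall>v. mem s (v + v + L) = count_list as v"
    and "\<forall>v. mem s (Suc (v + v + L)) = pos_choose r (count_list as v)"
  shows "\<exists>t\<le>25 * length ws + 2. reaches sink_program N t s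
    (\<lambda>s. pc s = 39 \<and> reg s 0 = t0 + choose_sum r (as @ arc_targets c ws))"
  using assms(8-)
proof (induction ws arbitrary: as c p s)
  case (Nil as c p s)
  obtain R M where s: "s = \<lparr>pc = 12, reg = R, mem = M\<rparr>"
    using Nil.prems(1) by (cases s) auto
  have "p = L" using Nil.prems L by simp
  then have "reaches sink_program N 2 s (\<lambda>s. pc s = 39 \<and> reg s 0 = R 0)"
    unfolding s using Nil.prems by (intro sink_program_halt) (simp_all add: s)
  then show ?case using Nil.prems by (intro exI[of _ 2]) (simp add: s)
next
  case (Cons w ws as c p s)
  obtain R M where s: "s = \<lparr>pc = 12, reg = R, mem = M\<rparr>"
    using Cons.prems(1) by (cases s) auto
  have p: "p < L" "xs ! p = w" "drop (Suc p) xs = ws"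
    using Cons.prems(10) L
    by (metis drop_eq_Nil2 leI list.distinct(1), metis nth_via_drop, metis drop_Suc list.sel(3) tl_drop)
  then have w: "w < K" "M p = w" using xs L Cons.prems(13) by (auto simp: s)
  have K: "K \<le> K * K" "1 \<le> K" using L by auto
  show ?case
  proof (cases c)
    case 0
    have "reaches sink_program N 7 s
       (\<lambda>s. pc s = 12 \<and> reg s 0 = R 0 \<and> reg s 2 = 1 \<and> reg s 3 = Suc (R 3) \<and> reg s 4 = R 4 \<and>
         reg s 5 = M (R 3) \<and> reg s 9 = R 9 \<and> mem s = M)"
      unfolding s using Cons.prems 0 p by (intro sink_program_degree) (simp_all add: s)
    then have "\<exists>t\<le>7 + (25 * length ws + 2). reaches sink_program N t s
        (\<lambda>s. pc s = 39 \<and> reg s 0 = t0 + choose_sum r (as @ arc_targets w ws))"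
      using Cons.prems p w by (elim reaches_trans) (rule Cons.IH[where p = "Suc p"], auto simp: s)
    then obtain t where "t \<le> 7 + (25 * length ws + 2)" "reaches sink_program N t s
        (\<lambda>s. pc s = 39 \<and> reg s 0 = t0 + choose_sum r (as @ arc_targets w ws))"
      by blast
    then show ?thesis using 0 by (intro exI[of _ t]) simp
  next
    case (Suc c')
    define d where "d = count_list as w"
    \<comment> \<open>At most \<open>p < L\<close> targets have been processed, so even the new
      count is at most \<open>L\<close>.\<close>
    have d: "Suc d \<le> L"
      using count_le_length[of as w] Cons.prems(11) p by (simp add: d_def)
    have B: "pos_choose r d' \<le> K" if "d' \<le> L" for d'
      using pos_choose_le[of r d'] power_increasing[OF that, of "2::nat"] L by linarith
    have total: "t0 + choose_sum r (as @ [w]) \<le> K + K * K"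
      using choose_sum_le[of "as @ [w]" L r] mult_le_mono[of L K "2 ^ L" K]
        Cons.prems(11) p L \<open>t0 \<le> K\<close> by simp
    have Bd: "pos_choose r d * Suc d \<le> K * K"
      using B[of d] d L by (intro mult_le_mono) auto
    have snoc: "choose_sum r (as @ [w]) =
        choose_sum r as + (pos_choose r (Suc d) - pos_choose r d)"
      by (simp add: choose_sum_snoc d_def)
    have "reaches sink_program N 25 s
       (\<lambda>s. pc s = 12 \<and> reg s 0 = R 0 + (pos_choose r (Suc d) - pos_choose r d) \<and> reg s 2 = 1 \<and>
         reg s 3 = Suc (R 3) \<and> reg s 4 = r \<and> reg s 5 = c' \<and> reg s 9 = L \<and>
         mem s = M(w + w + L := Suc d, Suc (w + w + L) := pos_choose r (Suc d)))"
      unfolding s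
    proof (rule sink_program_target)
      show "pos_choose r d * Suc d div (Suc d - r) + Suc 0 div Suc (r - Suc d + (Suc d - r)) =
          pos_choose r (Suc d)"
        by (simp only: pos_choose_Suc)
      show "Suc (w + w + L) < N" "Suc (r + Suc d) < N"
        using w L N K d \<open>r < K\<close> by linarith+
      show "pos_choose r d * Suc d < N" using Bd N K by linarith
      show "pos_choose r (Suc d) < N" using B[OF d] N K by linarith
      show "R 0 + (pos_choose r (Suc d) - pos_choose r d) < N"
        using Cons.prems(4) total N K unfolding snoc s ram_state.simps by linarith
    qed (use Cons.prems Suc p w in \<open>simp_all add: s d_def\<close>)
    then have "\<exists>t\<le>25 + (25 * length ws + 2). reaches sink_program N t s
        (\<lambda>s. pc s = 39 \<and> reg s 0 = t0 + choose_sum r ((as @ [w]) @ arc_targets c' ws))"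
    proof (rule reaches_trans, elim conjE, intro Cons.IH[where p = "Suc p"])
      fix s' assume s': "mem s' = M(w + w + L := Suc d, Suc (w + w + L) := pos_choose r (Suc d))"
      \<comment> \<open>Parity relative to \<open>L\<close> separates the count cells from the
        coefficient cells; all of them lie beyond the input.\<close>
      have addr: "v + v + L \<noteq> Suc (w + w + L)" "Suc (v + v + L) \<noteq> w + w + L"
        "v + v + L = w + w + L \<longleftrightarrow> v = w" for v
        by presburger+
      assume "below N (mem s')"
      then show "below N (mem s')" .
      show "\<forall>v. mem s' (v + v + L) = count_list (as @ [w]) v"
        using Cons.prems(14) addr by (auto simp: s s' d_def)
      show "\<forall>v. mem s' (Suc (v + v + L)) = pos_choose r (count_list (as @ [w]) v)"
        using Cons.prems(15) addr by (auto simp: s s' d_def)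
    qed (use Cons.prems p in \<open>simp_all add: s snoc\<close>)
    then show ?thesis using Suc by simp
  qed
qed

section \<open>Bit-length bounds and linear running time\<close>

lemma length_le_input_bits: "length xs \<le> input_bits xs"
  unfolding input_bits_def by (induction xs) auto

lemma less_two_power_input_bits: "x \<in> set xs \<Longrightarrow> x < 2 ^ input_bits xs"
proof -
  assume "x \<in> set xs"
  then have "floorlog 2 x \<le> input_bits xs"
    unfolding input_bits_def by (induction xs) auto
  then show ?thesis by (intro floorlog_leD) auto
qed

text \<open>The constant 40 is generous for both purposes: 12 initial steps plus the loop, and the
  exponent needed for \<open>8 * (K * K)\<close>.\<close>

lemma sink_program_correct:
  assumes "xs = k # n # ws" "n \<le> length ws" and N: "N = 2 ^ (40 * Suc (input_bits xs))"
  shows "\<exists>t\<le>40 * Suc (length xs). reaches sink_program N t (init_state xs)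
    (\<lambda>s. pc s = 39 \<and>
         reg s 0 = (if k = 1 then n else 0) + choose_sum (k - 1) (arc_targets 0 ws))"
proof -
  define K :: nat where "K = 2 ^ input_bits xs"
  have len: "length xs < K" "2 ^ length xs \<le> K"
    using length_le_input_bits[of xs] less_exp[of "input_bits xs"]
    by (auto simp: K_def simp del: less_exp)
  have mem: "\<forall>x\<in>set xs. x < K" using less_two_power_input_bits by (auto simp: K_def)
  have "8 * (K * K) = 2 ^ (3 + input_bits xs + input_bits xs)" by (simp only: K_def power_add mult.assoc) simp
  also have "\<dots> \<le> N" unfolding N by (intro power_increasing) auto
  finally have N8: "8 * (K * K) \<le> N" .
  have K: "K \<le> K * K" "1 \<le> K" using len by auto
  have k: "k < K" "n < K" using mem assms(1) by auto
  let ?R = "\<lambda>i. if i = 0 then length xs else 0"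
  let ?M = "\<lambda>i. if i < length xs then xs ! i else 0"
  have "K \<le> N" and bounds: "k + 3 < N" "n < N" using k K N8 by linarith+
  then have "below N ?R" "below N ?M"
    using len mem K by (auto simp: below_def intro: less_le_trans)
  then have "reaches sink_program N 12 (init_state xs)
    (\<lambda>s. pc s = 12 \<and> reg s 0 = (if k = 1 then n else 0) \<and> reg s 2 = 1 \<and> reg s 3 = 2 \<and>
         reg s 4 = k - 1 \<and> reg s 5 = 0 \<and> reg s 9 = length xs \<and> mem s = ?M)"
    unfolding init_state_def using bounds
    by (intro sink_program_start) (simp_all add: assms(1))
  then have "\<exists>t\<le>12 + (25 * length ws + 2). reaches sink_program N t (init_state xs)
    (\<lambda>s. pc s = 39 \<and>
         reg s 0 = (if k = 1 then n else 0) + choose_sum (k - 1) ([] @ arc_targets 0 ws))"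
  proof (rule reaches_trans, elim conjE, intro sink_program_loop[OF refl len mem _ _ N8, where p = 2])
    fix s' :: ram_state
    show "k - 1 < K" "(if k = 1 then n else 0) \<le> K" using k by auto
  \<comment> \<open>Memory beyond the input is initially 0, which is the right count and coefficient
    when \<open>as\<close> is empty.\<close>
  qed (auto simp: assms(1) choose_sum_def)
  then obtain t where "t \<le> 12 + (25 * length ws + 2)" "reaches sink_program N t (init_state xs)
    (\<lambda>s. pc s = 39 \<and>
         reg s 0 = (if k = 1 then n else 0) + choose_sum (k - 1) (arc_targets 0 ws))"
    by auto
  then show ?thesis using assms(1) by (intro exI[of _ t]) simp
qed

lemma linear_time_solvable_count_sink_problem: "linear_time_solvable count_sink_problem"
  unfolding linear_time_solvable_def
proof (rule exI[of _ sink_program], rule exI[of _ 40], intro allI impI)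
  fix xs y
  assume "count_sink_problem xs y"
  then obtain G :: "(nat, nat \<times> nat) pre_digraph" and k where
    G: "oriented_digraph G" "encodes xs G k" and y: "y = num_ind_sub has_sink G k"
    unfolding count_sink_problem_def by blast
  from encodes_num_ind_sub_has_sink[OF G] obtain n ws where
    xs: "xs = k # n # ws" "n \<le> length ws"
    and y': "y = (if k = 1 then n else 0) + choose_sum (k - 1) (arc_targets 0 ws)"
    using y by metis
  from sink_program_correct[OF xs refl, folded y']
  obtain t where "t \<le> 40 * Suc (length xs)"
    "reaches sink_program (2 ^ (40 * Suc (input_bits xs))) t (init_state xs)
      (\<lambda>s. pc s = 39 \<and> reg s 0 = y)"
    by blast
  then show "\<exists>t\<le>40 * Suc (length xs).
      halted sink_program (run sink_program xs t) \<and> reg (run sink_program xs t) 0 = y \<and>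
      (\<forall>t'\<le>t. \<forall>i.
        reg (run sink_program xs t') i < 2 ^ (40 * Suc (input_bits xs)) \<and>
        mem (run sink_program xs t') i < 2 ^ (40 * Suc (input_bits xs)))"
    unfolding reaches_iff run_def below_def halted_def length_sink_program
    by (intro exI[of _ t]) simp
qed


section \<open>Nontriviality\<close>

text \<open>A star with all arcs directed to its centre 0.\<close>

lemma exists_oriented_digraph_has_sink:
  assumes "k \<ge> 1"
  shows "\<exists>G :: (nat, nat \<times> nat) pre_digraph.
    oriented_digraph G \<and> card (verts G) = k \<and> has_sink G"
proof -
  let ?G = "\<lparr>verts = {..<k}, arcs = {0<..<k} \<times> {0}, tail = fst, head = snd\<rparr>"
  have dom: "u \<rightarrow>\<^bsub>?G\<^esub> v \<longleftrightarrow> 0 < u \<and> u < k \<and> v = 0" for u v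
    by (force simp: arcs_ends_def arc_to_ends_def)
  have "digraph ?G"
    using assms by unfold_locales (auto simp: arc_to_ends_def)
  then have "oriented_digraph ?G" by (auto simp: oriented_digraph_def dom)
  moreover have "is_sink ?G 0" using assms by (auto simp: is_sink_def dom)
  ultimately show ?thesis by (intro exI[of _ ?G]) (auto simp: has_sink_def)
qed

text \<open>In an arcless graph a sink would have to be the only vertex.\<close>

lemma exists_oriented_digraph_no_sink:
  assumes "k \<ge> 2"
  shows "\<exists>G :: (nat, nat \<times> nat) pre_digraph.
    oriented_digraph G \<and> card (verts G) = k \<and> \<not> has_sink G"
proof -
  let ?G = "\<lparr>verts = {..<k}, arcs = {}, tail = fst, head = snd\<rparr> :: (nat, nat \<times> nat) pre_digraph"
  have dom: "\<not> u \<rightarrow>\<^bsub>?G\<^esub> v" for u v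
    by (simp add: arcs_ends_def)
  have "digraph ?G" by unfold_locales auto
  then have "oriented_digraph ?G" by (auto simp: oriented_digraph_def dom)
  moreover have "\<not> is_sink ?G s" for s
  proof
    assume "is_sink ?G s"
    then have "{..<k} \<subseteq> {s}" using dom by (auto simp: is_sink_def)
    then have "card {..<k} \<le> card {s}" by (intro card_mono) auto
    then show False using assms by simp
  qed
  ultimately show ?thesis by (intro exI[of _ ?G]) (auto simp: has_sink_def)
qed

theorem mainTheorem3:
  shows "(\<forall>k\<ge>2.
            (\<exists>G :: (nat, nat \<times> nat) pre_digraph.
               oriented_digraph G \<and> card (verts G) = k \<and> has_sink G) \<and>
            (\<exists>G :: (nat, nat \<times> nat) pre_digraph.
               oriented_digraph G \<and> card (verts G) = k \<and> \<not> has_sink G))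
         \<and> linear_time_solvable count_sink_problem"
  using exists_oriented_digraph_has_sink exists_oriented_digraph_no_sink
    linear_time_solvable_count_sink_problem by simp

end
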